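(* Consider an instance of the TSP-mD in which only a single drone is available ($m=1$), all feasible sorties are invertible, and every feasible sortie serves at most one customer (i.e. has the form $(i_1,i_2,i_3)$). Then at least one optimal solution is not arc-retraversing.
   Context: Instance. An instance of the TSP-mD (Traveling Salesman Problem with Drones) consists of a finite set $N$ of nodes with a depot $0\in N$; the complete directed graph with arc set $A=\{(i,j)\in N\times N: i\neq j\}$; subsets $N^{tr},N^{dr}\subseteq N$ (nodes that can be served by the truck, resp. by the drones) with $N^{tr}\cup N^{dr}=N$ and $0\in N^{tr}$; two metrics $\ell,\ell'$ on $N$ ($\ell_{ij}$, resp. $\ell'_{ij}$, is the time the truck, resp. a drone, needs to traverse $(i,j)$); a number $m\ge 1$ of identical drones; a drone weight $w^{dr}>0$; payloads $w_i\ge 0$ for $i\in N^{dr}$; and a battery capacity $B>0$. Sorties. A sortie is a tuple $\pi=(i_1,\dots,i_r)$, $r\ge 3$, with $i_1,i_r\in N^{tr}$, $i_2,\dots,i_{r-1}\in N^{dr}$ and consecutive nodes distinct ($i_1=i_r$ is allowed). It serves the nodes $N[\pi]=\{i_2,\dots,i_{r-1}\}$ and has duration $\ell'_\pi=\sum_{q=1}^{r-1}\ell'_{i_qi_{q+1}}$. Its energy consumption is $w^{dr}\sum_{q=1}^{r-1}\ell'_{i_qi_{q+1}}+\sum_{p=2}^{r-1}\bigl(w_{i_p}\sum_{q=1}^{p-1}\ell'_{i_qi_{q+1}}\bigr)$, and it is feasible if this is at most $B$. A feasible sortie $(i_1,\dots,i_r)$ is invertible if the reversed sortie $(i_r,\dots,i_1)$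 is feasible as well. Solutions. A (feasible) solution consists of a truck route, which is a closed walk $0=v_0,v_1,\dots,v_n=0$ with all $v_t\in N^{tr}$ and consecutive nodes distinct (nodes and arcs may be repeated), and a finite family of feasible sorties, each assigned to a drone and to a pair of visit indices $s\le e$ such that the sortie starts at $v_s$ (launch from the truck at its visit number $s$) and ends at $v_e$ (retrieval by the truck at visit number $e$). The sorties of the same drone are performed one after the other (each one is launched at or after the visit at which the previous one was retrieved, and after that retrieval). Every node of $N$ must be on the truck route or served by some sortie. The truck starts at time $0$; it may wait at nodes, a drone may wait at its landing node for the truck, a sortie with duration $\ell'_\pi$ launched while the truck is at visit $s$ lands $\ell'_\pi$ time units after launch, and the truck may not leave visit $e$ before the drone has landed. Launching, retrieving, serving and battery swapping take no time. The completion time is the earliest time at which the truck has completed its route and all drones have been retrieved at the depot or earlier; it is to be minimized over all solutions, and a solution is optimal if it attains the minimum. Only instances admitting at least one feasible solution are considered. A solution is arc-retraversing if its truck route traverses some arc $(i,j)\in A$ (in the direction from $i$ to $j$) more than once. *)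

theory Defs
  imports "HOL-Analysis.Analysis"
begin

record 'a tspmd =
  nodes :: "'a set"
  depot :: 'a
  truck_nodes :: "'a set"
  drone_nodes :: "'a set"
  truck_time :: "'a \<Rightarrow> 'a \<Rightarrow> real"
  drone_time :: "'a \<Rightarrow> 'a \<Rightarrow> real"
  num_drones :: nat
  drone_weight :: real
  payload :: "'a \<Rightarrow> real"
  battery :: real

(* Metric_space also asks for non-negativity and symmetry outside the carrier. These values are
   never used, and every metric on the nodes extends in this way (by 0). *)
definition tspmd_instance :: "'a tspmd \<Rightarrow> bool" where
  "tspmd_instance I \<longleftrightarrow>
     finite (nodes I) \<and>
     depot I \<in> truck_nodes I \<and>
     truck_nodes I \<union> drone_nodes I = nodes I \<and>
     Metric_space (nodes I) (truck_time I) \<and>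
     Metric_space (nodes I) (drone_time I) \<and>
     num_drones I \<ge> 1 \<and>
     drone_weight I > 0 \<and>
     (\<forall>i\<in>drone_nodes I. payload I i \<ge> 0) \<and>
     battery I > 0"

definition arcs :: "'a tspmd \<Rightarrow> ('a \<times> 'a) set" where
  "arcs I = {(i, j). i \<in> nodes I \<and> j \<in> nodes I \<and> i \<noteq> j}"

definition is_sortie :: "'a tspmd \<Rightarrow> 'a list \<Rightarrow> bool" where
  "is_sortie I \<pi> \<longleftrightarrow>
     length \<pi> \<ge> 3 \<and>
     hd \<pi> \<in> truck_nodes I \<and> last \<pi> \<in> truck_nodes I \<and>
     set (butlast (tl \<pi>)) \<subseteq> drone_nodes I \<and>
     distinct_adj \<pi>"

definition served :: "'a list \<Rightarrow> 'a set" where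
  "served \<pi> = set (butlast (tl \<pi>))"

(* Lists are indexed from 0: flight_time I \<pi> p is the time from launch to the (p+1)-st node
   of the sortie. *)
definition flight_time :: "'a tspmd \<Rightarrow> 'a list \<Rightarrow> nat \<Rightarrow> real" where
  "flight_time I \<pi> p = (\<Sum>q<p. drone_time I (\<pi> ! q) (\<pi> ! Suc q))"

definition duration :: "'a tspmd \<Rightarrow> 'a list \<Rightarrow> real" where
  "duration I \<pi> = flight_time I \<pi> (length \<pi> - 1)"

definition energy :: "'a tspmd \<Rightarrow> 'a list \<Rightarrow> real" where
  "energy I \<pi> = drone_weight I * duration I \<pi> +
     (\<Sum>p = 1..<length \<pi> - 1. payload I (\<pi> ! p) * flight_time I \<pi> p)"

definition feasible_sortie :: "'a tspmd \<Rightarrow> 'a list \<Rightarrow> bool" where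
  "feasible_sortie I \<pi> \<longleftrightarrow> is_sortie I \<pi> \<and> energy I \<pi> \<le> battery I"

definition invertible_sortie :: "'a tspmd \<Rightarrow> 'a list \<Rightarrow> bool" where
  "invertible_sortie I \<pi> \<longleftrightarrow> feasible_sortie I \<pi> \<and> feasible_sortie I (rev \<pi>)"

lemma card_served_le_1_iff:
  assumes "is_sortie I \<pi>"
  shows "card (served \<pi>) \<le> 1 \<longleftrightarrow> length \<pi> = 3"
proof -
  from assms have "length \<pi> \<ge> 3" by (simp add: is_sortie_def)
  then obtain a b c ys where \<pi>: "\<pi> = a # b # c # ys"
    by (auto simp: numeral_3_eq_3 Suc_le_length_iff)
  show ?thesis
  proof (cases ys)
    case Nil
    then show ?thesis by (simp add: \<pi> served_def)
  next
    case (Cons y zs)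
    have "b \<noteq> c" using assms by (simp add: is_sortie_def \<pi>)
    moreover have "{b, c} \<subseteq> served \<pi>" by (simp add: \<pi> served_def Cons)
    ultimately have "card (served \<pi>) \<ge> 2"
      using card_mono[of "served \<pi>" "{b, c}"] by (simp add: served_def)
    then show ?thesis by (simp add: \<pi> Cons)
  qed
qed

(* A sortie together with the truck visits (positions in the truck route) at which the drone is
   launched and retrieved. *)
record 'a flight =
  path :: "'a list"
  launch_visit :: nat
  land_visit :: nat

(* flights S ! d lists the flights assigned to drone d in the order in which they are performed. *)
record 'a solution =
  route :: "'a list"
  flights :: "'a flight list list"

abbreviation last_visit :: "'a solution \<Rightarrow> nat" where
  "last_visit S \<equiv> length (route S) - 1"

definition is_truck_route :: "'a tspmd \<Rightarrow> 'a list \<Rightarrow> bool" where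
  "is_truck_route I vs \<longleftrightarrow>
     vs \<noteq> [] \<and> hd vs = depot I \<and> last vs = depot I \<and>
     set vs \<subseteq> truck_nodes I \<and> distinct_adj vs"

definition is_flight :: "'a tspmd \<Rightarrow> 'a list \<Rightarrow> 'a flight \<Rightarrow> bool" where
  "is_flight I vs f \<longleftrightarrow>
     feasible_sortie I (path f) \<and>
     launch_visit f \<le> land_visit f \<and> land_visit f < length vs \<and>
     hd (path f) = vs ! launch_visit f \<and> last (path f) = vs ! land_visit f"

definition feasible_solution :: "'a tspmd \<Rightarrow> 'a solution \<Rightarrow> bool" where
  "feasible_solution I S \<longleftrightarrow>
     is_truck_route I (route S) \<and>
     length (flights S) = num_drones I \<and>
     (\<forall>fs \<in> set (flights S).
        (\<forall>f \<in> set fs. is_flight I (route S) f) \<and>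
        sorted_wrt (\<lambda>f g. land_visit f \<le> launch_visit g) fs) \<and>
     nodes I \<subseteq> set (route S) \<union> (\<Union>fs \<in> set (flights S). \<Union>f \<in> set fs. served (path f))"

(* Arrival and departure times of the truck per visit; launch and retrieval times of the k-th
   flight of drone d. *)
record schedule =
  arr :: "nat \<Rightarrow> real"
  dep :: "nat \<Rightarrow> real"
  launch_time :: "nat \<Rightarrow> nat \<Rightarrow> real"
  retrieve_time :: "nat \<Rightarrow> nat \<Rightarrow> real"

(* The drone lands exactly duration time units after its launch; retrieval may be later, when the
   drone has to wait for the truck. The truck is present during launch and retrieval. *)
definition valid_schedule :: "'a tspmd \<Rightarrow> 'a solution \<Rightarrow> schedule \<Rightarrow> bool" where
  "valid_schedule I S \<sigma> \<longleftrightarrow>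
     arr \<sigma> 0 = 0 \<and>
     (\<forall>t \<le> last_visit S. arr \<sigma> t \<le> dep \<sigma> t) \<and>
     (\<forall>t < last_visit S.
        arr \<sigma> (Suc t) = dep \<sigma> t + truck_time I (route S ! t) (route S ! Suc t)) \<and>
     (\<forall>d < length (flights S). \<forall>k < length (flights S ! d).
        let f = flights S ! d ! k; s = launch_visit f; e = land_visit f in
          arr \<sigma> s \<le> launch_time \<sigma> d k \<and> launch_time \<sigma> d k \<le> dep \<sigma> s \<and>
          launch_time \<sigma> d k + duration I (path f) \<le> retrieve_time \<sigma> d k \<and>
          arr \<sigma> e \<le> retrieve_time \<sigma> d k \<and> retrieve_time \<sigma> d k \<le> dep \<sigma> e) \<and>
     (\<forall>d < length (flights S). \<forall>k. Suc k < length (flights S ! d) \<longrightarrow>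
        retrieve_time \<sigma> d k \<le> launch_time \<sigma> d (Suc k))"

(* The time dep \<sigma> (last_visit S) bounds the last arrival of the truck and all retrievals from
   above. A feasible solution has a valid schedule (the truck may wait), see below. *)
definition completion_time :: "'a tspmd \<Rightarrow> 'a solution \<Rightarrow> real" where
  "completion_time I S = Inf {dep \<sigma> (last_visit S) |\<sigma>. valid_schedule I S \<sigma>}"

definition optimal_solution :: "'a tspmd \<Rightarrow> 'a solution \<Rightarrow> bool" where
  "optimal_solution I S \<longleftrightarrow>
     feasible_solution I S \<and>
     (\<forall>S'. feasible_solution I S' \<longrightarrow> completion_time I S \<le> completion_time I S')"

definition arc_retraversing :: "'a tspmd \<Rightarrow> 'a solution \<Rightarrow> bool" where
  "arc_retraversing I S \<longleftrightarrow>
     (\<exists>a \<in> arcs I. count_list (zip (route S) (tl (route S))) a > 1)"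

lemma duration_nonneg:
  assumes "tspmd_instance I"
  shows "duration I \<pi> \<ge> 0"
proof -
  interpret Metric_space "nodes I" "drone_time I"
    using assms by (simp add: tspmd_instance_def)
  show ?thesis by (simp add: duration_def flight_time_def sum_nonneg)
qed

lemma valid_schedule_exists:
  assumes I: "tspmd_instance I" and S: "feasible_solution I S"
  shows "\<exists>\<sigma>. valid_schedule I S \<sigma>"
proof -
  interpret T: Metric_space "nodes I" "truck_time I"
    using I by (simp add: tspmd_instance_def)
  define c where "c d k = (\<Sum>j<k. duration I (path (flights S ! d ! j)))" for d k
  define W where "W = (\<Sum>d<length (flights S). c d (length (flights S ! d)))"
  define a where "a t = (\<Sum>q<t. W + truck_time I (route S ! q) (route S ! Suc q))" for t
  define \<sigma> where "\<sigma> = \<lparr>arr = a, dep = (\<lambda>t. a t + W),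
    launch_time = (\<lambda>d k. a (launch_visit (flights S ! d ! k)) + c d k),
    retrieve_time = (\<lambda>d k. a (land_visit (flights S ! d ! k)) + c d (Suc k))\<rparr>"
  have c0: "c d k \<ge> 0" for d k
    unfolding c_def by (intro sum_nonneg duration_nonneg I)
  have cmono: "c d k \<le> c d k'" if "k \<le> k'" for d k k'
    unfolding c_def using that by (intro sum_mono2) (auto intro: duration_nonneg I)
  have cW: "c d k \<le> W" if "d < length (flights S)" "k \<le> length (flights S ! d)" for d k
  proof -
    have "c d k \<le> c d (length (flights S ! d))" by (rule cmono) fact
    also have "\<dots> \<le> W" unfolding W_def
      using that by (intro member_le_sum) (auto simp: c0)
    finally show ?thesis .
  qed
  have W0: "W \<ge> 0" unfolding W_def by (intro sum_nonneg c0)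
  have amono: "a t \<le> a t'" if "t \<le> t'" for t t'
    unfolding a_def using that W0 by (intro sum_mono2) auto
  have csuc: "c d (Suc k) = c d k + duration I (path (flights S ! d ! k))" for d k
    by (simp add: c_def)
  have se: "launch_visit (flights S ! d ! k) \<le> land_visit (flights S ! d ! k)"
    if "d < length (flights S)" "k < length (flights S ! d)" for d k
    using S that unfolding feasible_solution_def is_flight_def by (meson nth_mem)
  have nxt: "land_visit (flights S ! d ! k) \<le> launch_visit (flights S ! d ! Suc k)"
    if "d < length (flights S)" "Suc k < length (flights S ! d)" for d k
    using S that unfolding feasible_solution_def
    by (meson lessI nth_mem sorted_wrt_nth_less)
  have step: "a (Suc t) = a t + W + truck_time I (route S ! t) (route S ! Suc t)" for t
    by (simp add: a_def)
  have a0: "a 0 = 0" by (simp add: a_def)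
  have 1: "c d k + duration I (path (flights S ! d ! k)) \<le> W"
    if "d < length (flights S)" "k < length (flights S ! d)" for d k
    using cW[of d "Suc k"] that by (simp add: csuc)
  have "valid_schedule I S \<sigma>"
    unfolding valid_schedule_def Let_def \<sigma>_def
    using W0 c0 cW[OF _ less_imp_le] 1 a0 step
    by (auto simp: csuc duration_nonneg[OF I] intro!: amono nxt se add_mono)
  then show ?thesis by blast
qed

end

theory Submission
  imports Defs
begin

text \<open>
  With a single drone the flights occupy pairwise non-overlapping intervals of visits, so the
  completion time is the length of the truck route plus, for every flight, the amount by which its
  duration exceeds the length of the part of the route driven meanwhile. Suppose the arc
  \<open>(i, j)\<close> is traversed twice. If a visit to \<open>i\<close> or \<open>j\<close> in one of the traversals lies strictly inside a
  flight, the truck can skip it, as the node is visited in the other traversal as well. Otherwise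
  each traversal is accompanied by no flight or by exactly a flight \<open>(i, c, j)\<close>. Then the segment
  between the two traversals can be reversed, which removes both of them, while a flight
  \<open>(i, c, j)\<close> is replaced by one of the loops \<open>(i, c, i)\<close> and \<open>(j, c, j)\<close>: the one around the
  endpoint closer to \<open>c\<close> is feasible and not longer than \<open>(i, c, j)\<close>. Both modifications shorten
  the route, so only the finitely many non-retraversing plans have to be compared.
\<close>

section \<open>Cost of a truck route together with the flights of one drone\<close>

definition truck_length :: "'a tspmd \<Rightarrow> 'a list \<Rightarrow> nat \<Rightarrow> real" where
  "truck_length I vs t = (\<Sum>q<t. truck_time I (vs ! q) (vs ! Suc q))"

text \<open>The waiting that a flight forces on the truck. It is cut off at 0 since a drone that
  lands early waits without delaying the truck.\<close>

definition excess :: "'a tspmd \<Rightarrow> 'a list \<Rightarrow> 'a flight \<Rightarrow> real" where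
  "excess I vs f =
     max 0 (duration I (path f)
       - (truck_length I vs (land_visit f) - truck_length I vs (launch_visit f)))"

definition plan_cost :: "'a tspmd \<Rightarrow> 'a list \<Rightarrow> 'a flight set \<Rightarrow> real" where
  "plan_cost I vs F = truck_length I vs (length vs - 1) + (\<Sum>f\<in>F. excess I vs f)"

text \<open>Symmetric because the flights of a plan carry no order. Equality is allowed: a drone may
  be relaunched at the visit of its retrieval.\<close>

definition compatible :: "'a flight \<Rightarrow> 'a flight \<Rightarrow> bool" where
  "compatible f g \<longleftrightarrow> land_visit f \<le> launch_visit g \<or> land_visit g \<le> launch_visit f"

text \<open>
  Consecutive nodes of the route of a plan may coincide, so that skipping a visit and reversing a
  segment preserve the number of visits. Since the cost does not depend on the order of the
  flights, they form a set; the order is recovered in \<open>plan_solution\<close>.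
\<close>

definition is_plan :: "'a tspmd \<Rightarrow> 'a list \<Rightarrow> 'a flight set \<Rightarrow> bool" where
  "is_plan I vs F \<longleftrightarrow>
     vs \<noteq> [] \<and> hd vs = depot I \<and> last vs = depot I \<and> set vs \<subseteq> truck_nodes I \<and>
     finite F \<and> (\<forall>f\<in>F. is_flight I vs f) \<and> pairwise compatible F \<and>
     nodes I \<subseteq> set vs \<union> (\<Union>f\<in>F. served (path f))"

lemma truck_length_0 [simp]: "truck_length I vs 0 = 0"
  by (simp add: truck_length_def)

lemma truck_length_Suc [simp]:
  "truck_length I vs (Suc t) = truck_length I vs t + truck_time I (vs ! t) (vs ! Suc t)"
  by (simp add: truck_length_def)

lemma excess_nonneg [simp]: "excess I vs f \<ge> 0"
  by (simp add: excess_def)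

lemma duration_le_excess:
  "duration I (path f)
     \<le> truck_length I vs (land_visit f) - truck_length I vs (launch_visit f) + excess I vs f"
  by (simp add: excess_def)

lemma is_planI:
  assumes "vs \<noteq> []" "hd vs = depot I" "last vs = depot I" "set vs \<subseteq> truck_nodes I"
    and "finite F" "\<And>f. f \<in> F \<Longrightarrow> is_flight I vs f"
    and "\<And>f g. f \<in> F \<Longrightarrow> g \<in> F \<Longrightarrow> f \<noteq> g \<Longrightarrow> compatible f g"
    and "nodes I \<subseteq> set vs \<union> (\<Union>f\<in>F. served (path f))"
  shows "is_plan I vs F"
  using assms by (auto simp: is_plan_def pairwise_def)

text \<open>Cutting off at 0 is monotone, and adding \<open>c\<close> before it raises the result by
  at most \<open>c\<close>. In the applications, \<open>c\<close> bounds the driving time that a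
  modification removes while the drone is in the air.\<close>

lemma excess_shift:
  assumes "duration I (path g) \<le> duration I (path f)"
    and "truck_length I vs (land_visit f) - truck_length I vs (launch_visit f)
      \<le> truck_length I ws (land_visit g) - truck_length I ws (launch_visit g) + c"
    and "c \<ge> 0"
  shows "excess I ws g \<le> excess I vs f + c"
  using assms by (simp add: excess_def)

text \<open>Bookkeeping: \<open>c f\<close> is the extra waiting granted to the flight
  \<open>f\<close>, and the shortening of the route must pay for all of it. If \<open>\<phi>\<close>
  merges flights, the sum cannot grow, as every excess is nonnegative.\<close>

lemma plan_cost_image_le:
  assumes "finite F"
    and "\<And>f. f \<in> F \<Longrightarrow> excess I ws (\<phi> f) \<le> excess I vs f + c f"
    and "truck_length I ws (length ws - 1) + (\<Sum>f\<in>F. c f) \<le> truck_length I vs (length vs - 1)"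
  shows "plan_cost I ws (\<phi> ` F) \<le> plan_cost I vs F"
proof -
  have "(\<Sum>f\<in>\<phi> ` F. excess I ws f) \<le> (\<Sum>f\<in>F. excess I ws (\<phi> f))"
    using sum_image_le[OF assms(1), of "excess I ws" \<phi>] by (simp add: o_def)
  also have "\<dots> \<le> (\<Sum>f\<in>F. excess I vs f + c f)"
    by (intro sum_mono assms(2))
  finally show ?thesis
    using assms(3) by (simp add: plan_cost_def sum.distrib)
qed

subsection \<open>Plans and solutions with a single drone\<close>

lemma solution_plan:
  assumes S: "feasible_solution I S" and fs: "flights S = [fs]"
  shows "is_plan I (route S) (set fs)"
proof (rule is_planI)
  fix f g assume fg: "f \<in> set fs" "g \<in> set fs" "f \<noteq> g"
  then obtain i j where ij: "i < length fs" "j < length fs" "f = fs ! i" "g = fs ! j"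
    by (metis in_set_conv_nth)
  have srt: "sorted_wrt (\<lambda>f g. land_visit f \<le> launch_visit g) fs"
    using S fs by (simp add: feasible_solution_def)
  from fg ij have "i < j \<or> j < i" by (metis linorder_neqE_nat)
  then show "compatible f g"
    using sorted_wrt_nth_less[OF srt] ij by (auto simp: compatible_def)
qed (use S fs in \<open>auto simp: feasible_solution_def is_truck_route_def\<close>)

text \<open>Between launch and retrieval of a flight, the lag of the clock behind pure driving time
  grows by at least the excess. Flights of one drone follow one another, so these lags add
  up.\<close>

lemma plan_cost_le_dep:
  assumes I: "tspmd_instance I" and S: "feasible_solution I S" and fs: "flights S = [fs]"
    and \<sigma>: "valid_schedule I S \<sigma>"
  shows "plan_cost I (route S) (set fs) \<le> dep \<sigma> (last_visit S)"
proof -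
  define P where "P = truck_length I (route S)"
  define n where "n = last_visit S"
  define ex where "ex k = excess I (route S) (fs ! k)" for k
  define s where "s k = launch_visit (fs ! k)" for k
  define e where "e k = land_visit (fs ! k)" for k
  have fl: "is_flight I (route S) (fs ! k)" if "k < length fs" for k
    using S fs that by (simp add: feasible_solution_def)
  have en: "s k \<le> e k" "e k \<le> n" if "k < length fs" for k
    using fl[OF that] by (auto simp: is_flight_def s_def e_def n_def)
  have nxt: "e k \<le> s (Suc k)" if "Suc k < length fs" for k
  proof -
    have "sorted_wrt (\<lambda>f g. land_visit f \<le> launch_visit g) fs"
      using S fs by (simp add: feasible_solution_def)
    from sorted_wrt_nth_less[OF this, of k "Suc k"] that show ?thesis
      by (simp add: e_def s_def)
  qed
  have a0: "arr \<sigma> 0 = 0" and ad: "\<And>t. t \<le> n \<Longrightarrow> arr \<sigma> t \<le> dep \<sigma> t"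
    and as: "\<And>t. t < n \<Longrightarrow> arr \<sigma> (Suc t) = dep \<sigma> t + (P (Suc t) - P t)"
    using \<sigma> by (auto simp: valid_schedule_def n_def P_def)
  have fk: "arr \<sigma> (s k) \<le> launch_time \<sigma> 0 k" "launch_time \<sigma> 0 k \<le> dep \<sigma> (s k)"
    "launch_time \<sigma> 0 k + duration I (path (fs ! k)) \<le> retrieve_time \<sigma> 0 k"
    "arr \<sigma> (e k) \<le> retrieve_time \<sigma> 0 k" "retrieve_time \<sigma> 0 k \<le> dep \<sigma> (e k)"
    if "k < length fs" for k
    using \<sigma> that by (auto simp: valid_schedule_def fs Let_def s_def e_def)
  have rl: "retrieve_time \<sigma> 0 k \<le> launch_time \<sigma> 0 (Suc k)" if "Suc k < length fs" for k
    using \<sigma> that by (auto simp: valid_schedule_def fs Let_def)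
  have mono_dep: "dep \<sigma> t + (P t' - P t) \<le> dep \<sigma> t'" if "t \<le> t'" "t' \<le> n" for t t'
    using that
  proof (induction t' rule: dec_induct)
    case (step u)
    then show ?case using as[of u] ad[of "Suc u"] by simp
  qed simp
  \<comment> \<open>The visits must differ here: at a single visit the arrival may precede the
    departure.\<close>
  have mono_arr: "dep \<sigma> t + (P t' - P t) \<le> arr \<sigma> t'" if "t < t'" "t' \<le> n" for t t'
  proof -
    from that obtain u where "t' = Suc u" by (cases t') auto
    then show ?thesis using that mono_dep[of t u] as[of u] by simp
  qed
  have arrP: "P t \<le> arr \<sigma> t" if "t \<le> n" for t
    using that mono_arr[of 0 t] ad[of 0] a0 by (cases "t = 0") (auto simp: P_def)
  \<comment> \<open>Both the truck and the drone have to get from \<open>s k\<close> to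
    \<open>e k\<close>, which yields the maximum hidden in \<open>ex k\<close>. If the two visits
    coincide, a nonnegative duration takes the place of \<open>mono_arr\<close>.\<close>
  have exd: "retrieve_time \<sigma> 0 k \<ge> launch_time \<sigma> 0 k + (P (e k) - P (s k)) + ex k"
    if k: "k < length fs" for k
  proof -
    have "retrieve_time \<sigma> 0 k \<ge> launch_time \<sigma> 0 k + (P (e k) - P (s k))"
    proof (cases "s k = e k")
      case True
      then show ?thesis using fk(3)[OF k] duration_nonneg[OF I, of "path (fs ! k)"] by simp
    next
      case False
      then show ?thesis
        using mono_arr[of "s k" "e k"] en[OF k] fk(2,4)[OF k] by simp
    qed
    then show ?thesis
      using fk(3)[OF k] by (simp add: ex_def excess_def P_def e_def s_def max_def)
  qed
  have launch: "launch_time \<sigma> 0 k \<ge> P (s k) + (\<Sum>j<k. ex j)" if "k < length fs" for k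
    using that
  proof (induction k)
    case 0
    then show ?case using fk(1)[of 0] arrP[of "s 0"] en[of 0] by simp
  next
    case (Suc k)
    have r: "retrieve_time \<sigma> 0 k \<ge> P (e k) + (\<Sum>j<Suc k. ex j)"
      using Suc exd[of k] by simp
    show ?case
    \<comment> \<open>At a common visit only the sequence of the drone (\<open>rl\<close>) orders
      retrieval and launch; otherwise the truck drives in between.\<close>
    proof (cases "e k = s (Suc k)")
      case True
      then show ?thesis using r rl[of k] Suc.prems by simp
    next
      case False
      then have "dep \<sigma> (e k) + (P (s (Suc k)) - P (e k)) \<le> arr \<sigma> (s (Suc k))"
        using nxt[of k] en[of "Suc k"] Suc.prems by (intro mono_arr) auto
      then show ?thesis
        using r fk(5)[of k] fk(1)[of "Suc k"] Suc.prems by simp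
    qed
  qed
  have main: "P n + (\<Sum>j<length fs. ex j) \<le> dep \<sigma> n"
  proof (cases "length fs")
    case 0
    then show ?thesis using arrP[of n] ad[of n] by simp
  next
    case (Suc k)
    then have "retrieve_time \<sigma> 0 k \<ge> P (e k) + (\<Sum>j<Suc k. ex j)"
      using exd[of k] launch[of k] by simp
    then show ?thesis
      using fk(5)[of k] mono_dep[of "e k" n] en[of k] Suc by simp
  qed
  \<comment> \<open>A loop may occur several times in \<open>fs\<close> but only once in
    \<open>set fs\<close>, so the sums need not be equal.\<close>
  have "(\<Sum>f\<in>set fs. excess I (route S) f) = (\<Sum>f\<in>(!) fs ` {..<length fs}. excess I (route S) f)"
    by (rule arg_cong[where f = "sum _"]) (auto simp: set_conv_nth)
  also have "\<dots> \<le> (\<Sum>j<length fs. ex j)"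
    using sum_image_le[of "{..<length fs}" "excess I (route S)" "(!) fs"]
    by (simp add: o_def ex_def)
  finally show ?thesis
    using main by (simp add: plan_cost_def P_def n_def)
qed

lemma plan_cost_le_completion_time:
  assumes "tspmd_instance I" "feasible_solution I S" "flights S = [fs]"
  shows "plan_cost I (route S) (set fs) \<le> completion_time I S"
  unfolding completion_time_def
  using plan_cost_le_dep[OF assms] valid_schedule_exists[OF assms(1,2)]
  by (intro cInf_greatest) auto

text \<open>The lower bound is attained if the truck waits only for landings: its lag is then the
  total excess of the flights retrieved so far. With \<open>distinct fs\<close>, sums over the list
  and over its set agree.\<close>

lemma plan_schedule:
  assumes I: "tspmd_instance I" and S: "feasible_solution I S" and fs: "flights S = [fs]"
    and "distinct fs"
  shows "\<exists>\<sigma>. valid_schedule I S \<sigma> \<and>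
    dep \<sigma> (last_visit S) = plan_cost I (route S) (set fs)"
proof -
  define P where "P = truck_length I (route S)"
  define n where "n = last_visit S"
  define ex where "ex k = excess I (route S) (fs ! k)" for k
  define s where "s k = launch_visit (fs ! k)" for k
  define e where "e k = land_visit (fs ! k)" for k
  define m where "m = length fs"
  have fl: "is_flight I (route S) (fs ! k)" if "k < m" for k
    using S fs that by (simp add: feasible_solution_def m_def)
  have en: "s k \<le> e k" "e k \<le> n" if "k < m" for k
    using fl[OF that] by (auto simp: is_flight_def s_def e_def n_def)
  have nxt: "e j \<le> s k" if "j < k" "k < m" for j k
  proof -
    have "sorted_wrt (\<lambda>f g. land_visit f \<le> launch_visit g) fs"
      using S fs by (simp add: feasible_solution_def)
    from sorted_wrt_nth_less[OF this, of j k] that show ?thesis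
      by (simp add: e_def s_def m_def)
  qed
  \<comment> \<open>Arrival counts the flights retrieved strictly before visit \<open>t\<close>,
    departure also those retrieved at \<open>t\<close>. A launch comes after the \<open>k\<close>
    earlier flights; \<open>Suc k\<close> adds the excess of the flight itself.\<close>
  define \<sigma> where "\<sigma> = \<lparr>
    arr = (\<lambda>t. P t + (\<Sum>j | j < m \<and> e j < t. ex j)),
    dep = (\<lambda>t. P t + (\<Sum>j | j < m \<and> e j \<le> t. ex j)),
    launch_time = (\<lambda>d k. P (s k) + (\<Sum>j<k. ex j)),
    retrieve_time = (\<lambda>d k. P (e k) + (\<Sum>j<Suc k. ex j))\<rparr>"
  have ex0: "ex j \<ge> 0" for j by (simp add: ex_def)
  \<comment> \<open>These inclusions place each launch and each retrieval between the arrival and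
    the departure of the truck.\<close>
  have subs: "{j. j < m \<and> e j < s k} \<subseteq> {..<k}" "{..<k} \<subseteq> {j. j < m \<and> e j \<le> s k}"
    "{j. j < m \<and> e j < e k} \<subseteq> {..<Suc k}" "{..<Suc k} \<subseteq> {j. j < m \<and> e j \<le> e k}"
    if k: "k < m" for k
  proof -
    have "j < Suc k" if "j < m" "e j < e k" for j
      using nxt[of k j] en[of j] that k by (meson leD le_trans linorder_not_less not_less_eq)
    then show "{j. j < m \<and> e j < e k} \<subseteq> {..<Suc k}" by auto
    have "j < k" if "j < m" "e j < s k" for j
      using nxt[of k j] en[of j] en[of k] that k
      by (metis leD le_trans linorder_neqE_nat)
    then show "{j. j < m \<and> e j < s k} \<subseteq> {..<k}" by auto
    show "{..<k} \<subseteq> {j. j < m \<and> e j \<le> s k}" using nxt[of _ k] k by auto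
    have "e j \<le> e k" if "j < Suc k" for j
      using nxt[of j k] en[of k] that k by (metis le_trans less_SucE order_refl)
    then show "{..<Suc k} \<subseteq> {j. j < m \<and> e j \<le> e k}" using k by auto
  qed
  have sm: "sum ex A \<le> sum ex B" if "A \<subseteq> B" "finite B" for A B
    using that ex0 by (intro sum_mono2) auto
  have dur: "P (s k) + sum ex {..<k} + duration I (path (fs ! k)) \<le> P (e k) + sum ex {..<Suc k}" for k
    using duration_le_excess[of I "fs ! k" "route S"] by (simp add: P_def s_def e_def ex_def)
  have link: "P (e k) \<le> P (s (Suc k))" if "Suc k < m" for k
  proof -
    interpret T: Metric_space "nodes I" "truck_time I"
      using I by (simp add: tspmd_instance_def)
    show ?thesis
      unfolding P_def truck_length_def
      using nxt[of k "Suc k"] that by (intro sum_mono2) auto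
  qed
  have step: "P (Suc t) + (\<Sum>j | j < m \<and> e j < Suc t. ex j)
     = P t + (\<Sum>j | j < m \<and> e j \<le> t. ex j) + truck_time I (route S ! t) (route S ! Suc t)" for t
    by (simp add: P_def less_Suc_eq_le)
  have "valid_schedule I S \<sigma>"
    unfolding valid_schedule_def Let_def
    using fs step
    apply (auto simp: \<sigma>_def P_def[symmetric] simp flip: s_def e_def m_def intro!: sm subs dur)
    subgoal by (simp add: P_def)
    subgoal for k using dur[of k] by simp
    subgoal for k using sm[OF subs(3)[of k]] by simp
    subgoal for k using sm[OF subs(4)[of k]] by simp
    subgoal for k using link[of k] by simp
    done
  moreover have "dep \<sigma> n = plan_cost I (route S) (set fs)"
  proof -
    have "{j. j < m \<and> e j \<le> n} = {..<m}" using en by auto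
    moreover have "sum ex {..<m} = (\<Sum>f\<in>set fs. excess I (route S) f)"
      using sum.reindex_bij_betw[OF bij_betw_nth[OF \<open>distinct fs\<close> refl refl], of "excess I (route S)"]
      by (simp add: ex_def m_def)
    ultimately show ?thesis by (simp add: \<sigma>_def plan_cost_def P_def n_def)
  qed
  ultimately show ?thesis by (auto simp: n_def)
qed

lemma completion_time_le_plan_cost:
  assumes I: "tspmd_instance I" and S: "feasible_solution I S" and fs: "flights S = [fs]"
    and "distinct fs"
  shows "completion_time I S \<le> plan_cost I (route S) (set fs)"
proof -
  obtain \<sigma> where \<sigma>: "valid_schedule I S \<sigma>" "dep \<sigma> (last_visit S) = plan_cost I (route S) (set fs)"
    using plan_schedule[OF assms] by blast
  have "bdd_below {dep \<sigma> (last_visit S) |\<sigma>. valid_schedule I S \<sigma>}"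
    using plan_cost_le_dep[OF I S fs] by (intro bdd_belowI) blast
  then show ?thesis
    unfolding completion_time_def using \<sigma> by (intro cInf_lower) force+
qed

lemma plan_solution:
  assumes I: "tspmd_instance I" "num_drones I = 1"
    and plan: "is_plan I vs F" and da: "distinct_adj vs"
  shows "\<exists>S. feasible_solution I S \<and> route S = vs \<and> completion_time I S \<le> plan_cost I vs F"
proof -
  \<comment> \<open>Sorting by launch visit alone could put a flight launched at \<open>t\<close>
    before a loop at \<open>t\<close>. With the sum, a tie between compatible flights occurs only
    for loops at the same visit, whose order is irrelevant.\<close>
  define key :: "'a flight \<Rightarrow> nat" where "key f = launch_visit f + land_visit f" for f
  obtain fs0 where fs0: "set fs0 = F" "distinct fs0"
    using plan finite_distinct_list unfolding is_plan_def by blast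
  define fs where "fs = sort_key key fs0"
  have fs: "set fs = F" "distinct fs" "sorted (map key fs)"
    using fs0 by (auto simp: fs_def)
  have "sorted_wrt (\<lambda>f g. land_visit f \<le> launch_visit g) fs"
    unfolding sorted_wrt_iff_nth_less
  proof (intro allI impI)
    fix i j assume ij: "i < j" "j < length fs"
    have ne: "fs ! i \<noteq> fs ! j" using ij fs(2) by (simp add: nth_eq_iff_index_eq)
    have mem: "fs ! i \<in> F" "fs ! j \<in> F" using ij fs(1) by auto
    have "compatible (fs ! i) (fs ! j)" using plan mem ne by (auto simp: is_plan_def pairwise_def)
    moreover have "key (fs ! i) \<le> key (fs ! j)"
      using fs(3) ij by (auto simp: sorted_iff_nth_mono_less)
    moreover have "launch_visit f \<le> land_visit f" if "f \<in> F" for f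
      using plan that by (auto simp: is_plan_def is_flight_def)
    ultimately show "land_visit (fs ! i) \<le> launch_visit (fs ! j)"
      using mem unfolding compatible_def key_def by fastforce
  qed
  then have S: "feasible_solution I \<lparr>route = vs, flights = [fs]\<rparr>"
    using plan da fs(1) I(2)
    by (auto simp: feasible_solution_def is_plan_def is_truck_route_def)
  with completion_time_le_plan_cost[OF I(1) S _ fs(2)] fs(1) show ?thesis
    by (intro exI[of _ "\<lparr>route = vs, flights = [fs]\<rparr>"]) simp
qed

subsection \<open>Shortening a plan\<close>

lemma truck_time_facts:
  assumes "tspmd_instance I"
  shows "truck_time I x y \<ge> 0" "truck_time I x y = truck_time I y x"
    and "x \<in> nodes I \<Longrightarrow> truck_time I x x = 0"
    and "x \<in> nodes I \<Longrightarrow> y \<in> nodes I \<Longrightarrow> z \<in> nodes I \<Longrightarrow>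
      truck_time I x z \<le> truck_time I x y + truck_time I y z"
proof -
  interpret Metric_space "nodes I" "truck_time I"
    using assms by (simp add: tspmd_instance_def)
  show "truck_time I x y \<ge> 0" "truck_time I x y = truck_time I y x"
    by (simp_all add: commute)
  show "x \<in> nodes I \<Longrightarrow> truck_time I x x = 0" by simp
  show "x \<in> nodes I \<Longrightarrow> y \<in> nodes I \<Longrightarrow> z \<in> nodes I \<Longrightarrow>
      truck_time I x z \<le> truck_time I x y + truck_time I y z"
    by (rule triangle)
qed

lemma drone_time_commute:
  assumes "tspmd_instance I"
  shows "drone_time I x y = drone_time I y x"
proof -
  interpret Metric_space "nodes I" "drone_time I"
    using assms by (simp add: tspmd_instance_def)
  show ?thesis by (rule commute)
qed

lemma plan_nth_in_nodes:
  assumes "tspmd_instance I" "is_plan I vs F" "t < length vs"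
  shows "vs ! t \<in> nodes I"
proof -
  have "vs ! t \<in> truck_nodes I" using assms(2,3) nth_mem unfolding is_plan_def by blast
  then show ?thesis using assms(1) unfolding tspmd_instance_def by blast
qed

text \<open>The step between the two equal visits takes no driving time, so merging them changes no
  driving time between visits. A flight from one to the other becomes a loop.\<close>

lemma plan_remove_repetition:
  assumes I: "tspmd_instance I" and plan: "is_plan I vs F"
    and p: "Suc p < length vs" "vs ! p = vs ! Suc p"
  shows "\<exists>ws G. is_plan I ws G \<and> plan_cost I ws G \<le> plan_cost I vs F \<and> length ws < length vs"
proof -
  \<comment> \<open>\<open>h\<close> takes new positions to old ones and skips \<open>Suc p\<close>;
    \<open>g\<close> goes back and sends both \<open>p\<close> and \<open>Suc p\<close> to
    \<open>p\<close>.\<close>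
  define h where "h t = (if t \<le> p then t else Suc t)" for t
  define g where "g t = (if t \<le> p then t else t - 1)" for t
  define ws where "ws = map (\<lambda>t. vs ! h t) [0..<length vs - 1]"
  define \<phi> :: "'a flight \<Rightarrow> 'a flight" where
    "\<phi> f = \<lparr>path = path f, launch_visit = g (launch_visit f), land_visit = g (land_visit f)\<rparr>" for f
  have len: "length ws = length vs - 1" by (simp add: ws_def)
  have g_less: "g t < length ws" if "t < length vs" for t
    using that p by (auto simp: g_def len)
  have nth_g: "ws ! g t = vs ! t" if "t < length vs" for t
  proof (cases "t = Suc p")
    case True
    then show ?thesis using p by (simp add: ws_def g_def h_def)
  next
    case False
    then have "h (g t) = t" by (auto simp: h_def g_def)
    then show ?thesis using g_less[OF that] by (simp add: ws_def)
  qed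
  have set_ws: "set ws = set vs"
  proof
    show "set ws \<subseteq> set vs" by (auto simp: ws_def h_def)
    show "set vs \<subseteq> set ws" by (metis g_less nth_g in_set_conv_nth subsetI)
  qed
  have ne: "ws \<noteq> []" using p len by auto
  have g_mono: "g t \<le> g t'" if "t \<le> t'" for t t' using that by (auto simp: g_def)
  have g_last: "g (length vs - 1) = length ws - 1" using p by (auto simp: g_def len)
  have fl: "is_flight I ws (\<phi> f)" if "f \<in> F" for f
    using plan that by (auto simp: is_plan_def is_flight_def \<phi>_def g_less nth_g g_mono)
  have P: "truck_length I ws (g t) = truck_length I vs t" if "t < length vs" for t
    using that
  proof (induction t)
    case 0
    then show ?case by (simp add: g_def)
  next
    case (Suc t)
    have "t = p \<or> g (Suc t) = Suc (g t)" by (auto simp: g_def)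
    then consider "t = p" | "g (Suc t) = Suc (g t)" by blast
    then show ?case
    proof cases
      case 1
      then have "g (Suc t) = g t" by (simp add: g_def)
      then show ?thesis
        using Suc 1 p truck_time_facts(3)[OF I] plan_nth_in_nodes[OF I plan] by simp
    next
      case 2
      then have "vs ! t = ws ! g t" "vs ! Suc t = ws ! Suc (g t)"
        using nth_g[of t] nth_g[of "Suc t"] Suc.prems by auto
      then show ?thesis using Suc 2 by simp
    qed
  qed
  have "is_plan I ws (\<phi> ` F)"
  proof (rule is_planI)
    show "hd ws = depot I"
      using plan ne nth_g[of 0] by (auto simp: is_plan_def hd_conv_nth g_def)
    show "last ws = depot I"
      using plan ne nth_g[of "length vs - 1"] g_last by (auto simp: is_plan_def last_conv_nth)
    show "compatible f f'" if ff: "f \<in> \<phi> ` F" "f' \<in> \<phi> ` F" "f \<noteq> f'" for f f'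
    proof -
      from ff obtain f0 f1 where f01: "f0 \<in> F" "f1 \<in> F" "f = \<phi> f0" "f' = \<phi> f1" "f0 \<noteq> f1" by blast
      then have "compatible f0 f1" using plan by (auto simp: is_plan_def pairwise_def)
      then show ?thesis using f01 g_mono by (auto simp: compatible_def \<phi>_def)
    qed
    show "nodes I \<subseteq> set ws \<union> (\<Union>f\<in>\<phi> ` F. served (path f))"
      using plan by (auto simp: is_plan_def set_ws \<phi>_def)
  qed (use plan ne fl set_ws in \<open>auto simp: is_plan_def\<close>)
  moreover have "plan_cost I ws (\<phi> ` F) \<le> plan_cost I vs F"
  proof (rule plan_cost_image_le[where c = "\<lambda>_. 0"])
    fix f assume "f \<in> F"
    then have "launch_visit f < length vs" "land_visit f < length vs"
      using plan by (auto simp: is_plan_def is_flight_def)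
    then show "excess I ws (\<phi> f) \<le> excess I vs f + 0"
      by (simp add: excess_def \<phi>_def P)
  next
    show "truck_length I ws (length ws - 1) + (\<Sum>f\<in>F. 0) \<le> truck_length I vs (length vs - 1)"
      using P[of "length vs - 1"] g_last p by simp
  qed (use plan in \<open>simp add: is_plan_def\<close>)
  moreover have "length ws < length vs" using p len by simp
  ultimately show ?thesis by blast
qed

text \<open>The truck waits one visit longer at the previous node and then drives on directly. The
  triangle inequality gives a saving, which covers the growth of the excess of \<open>f0\<close>;
  the node itself stays covered by visit \<open>q\<close>.\<close>

lemma plan_shortcut:
  assumes I: "tspmd_instance I" and plan: "is_plan I vs F"
    and f0: "f0 \<in> F" "launch_visit f0 < Suc r" "Suc r < land_visit f0"
    and q: "q < length vs" "q \<noteq> Suc r" "vs ! q = vs ! Suc r"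
  shows "is_plan I (vs[Suc r := vs ! r]) F
    \<and> plan_cost I (vs[Suc r := vs ! r]) F \<le> plan_cost I vs F"
proof -
  define ws where "ws = vs[Suc r := vs ! r]"
  define \<Delta> where "\<Delta> = truck_time I (vs ! r) (vs ! Suc r) + truck_time I (vs ! Suc r) (vs ! Suc (Suc r))
    - truck_time I (vs ! r) (vs ! Suc (Suc r))"
  have land0: "land_visit f0 < length vs"
    using plan f0 by (auto simp: is_plan_def is_flight_def)
  have rn: "Suc (Suc r) < length vs" using f0 land0 by simp
  have \<Delta>0: "\<Delta> \<ge> 0"
    using truck_time_facts(4)[OF I] plan_nth_in_nodes[OF I plan] rn by (simp add: \<Delta>_def)
  have nth_ws: "ws ! t = (if t = Suc r then vs ! r else vs ! t)" for t
    using rn by (auto simp: ws_def nth_list_update)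
  have P1: "truck_length I ws t = truck_length I vs t" if "t \<le> r" for t
    using that by (induction t) (simp_all add: nth_ws)
  have P2: "truck_length I ws t = truck_length I vs t - \<Delta>" if "Suc (Suc r) \<le> t" for t
    using that
  proof (induction t rule: dec_induct)
    case base
    have "truck_time I (vs ! r) (vs ! r) = 0"
      using truck_time_facts(3)[OF I] plan_nth_in_nodes[OF I plan] rn by simp
    then show ?case by (simp add: P1 nth_ws \<Delta>_def)
  qed (simp add: nth_ws)
  have apart: "land_visit f \<le> launch_visit f0 \<or> land_visit f0 \<le> launch_visit f"
    if "f \<in> F" "f \<noteq> f0" for f
    using plan that f0(1) unfolding is_plan_def pairwise_def compatible_def by blast
  have le: "launch_visit f \<le> land_visit f" if "f \<in> F" for f
    using plan that by (auto simp: is_plan_def is_flight_def)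
  \<comment> \<open>Every other flight ends before the launch of \<open>f0\<close> or starts after
    its landing, so no flight is attached to the changed visit.\<close>
  have off: "launch_visit f \<noteq> Suc r" "land_visit f \<noteq> Suc r" if "f \<in> F" for f
    using apart[OF that] le[OF that] f0 by (cases "f = f0"; force)+
  have set_ws: "set ws = set vs"
  proof
    show "set ws \<subseteq> set vs" unfolding ws_def using rn by (intro set_update_subsetI) auto
    show "set vs \<subseteq> set ws"
    proof
      fix x assume "x \<in> set vs"
      then obtain t where "t < length vs" "vs ! t = x" by (auto simp: in_set_conv_nth)
      then have "ws ! (if t = Suc r then q else t) = x" "(if t = Suc r then q else t) < length ws"
        using q by (auto simp: nth_ws) (auto simp: ws_def)
      then show "x \<in> set ws" using nth_mem by blast
    qed
  qed
  have "is_plan I ws F"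
  proof (rule is_planI)
    show "hd ws = depot I"
      using plan nth_ws[of 0] by (auto simp: is_plan_def hd_conv_nth ws_def)
    have "last ws = ws ! (length vs - 1)"
      using rn by (subst last_conv_nth) (auto simp: ws_def)
    also have "\<dots> = last vs"
      using rn by (subst last_conv_nth) (auto simp: nth_ws)
    finally show "last ws = depot I" using plan by (simp add: is_plan_def)
    show "is_flight I ws f" if "f \<in> F" for f
      using plan that off[OF that] by (auto simp: is_plan_def is_flight_def nth_ws) (simp add: ws_def)
    show "nodes I \<subseteq> set ws \<union> (\<Union>f\<in>F. served (path f))"
      using plan by (simp add: is_plan_def set_ws)
  qed (use plan set_ws in \<open>auto simp: is_plan_def pairwise_def ws_def\<close>)
  moreover have "plan_cost I ws (id ` F) \<le> plan_cost I vs F"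
  proof (rule plan_cost_image_le[where c = "\<lambda>f. if f = f0 then \<Delta> else 0"])
    fix f assume f: "f \<in> F"
    show "excess I ws (id f) \<le> excess I vs f + (if f = f0 then \<Delta> else 0)"
    proof (rule excess_shift)
      consider "f = f0" | "f \<noteq> f0" "land_visit f \<le> r" "launch_visit f \<le> r"
        | "f \<noteq> f0" "land_visit f \<ge> Suc (Suc r)" "launch_visit f \<ge> Suc (Suc r)"
        using apart[OF f] le[OF f] f0 by linarith
      then show "truck_length I vs (land_visit f) - truck_length I vs (launch_visit f)
        \<le> truck_length I ws (land_visit (id f)) - truck_length I ws (launch_visit (id f))
          + (if f = f0 then \<Delta> else 0)"
        using f0 by cases (auto simp: P1 P2)
    qed (use \<Delta>0 in auto)
  next
    show "truck_length I ws (length ws - 1) + (\<Sum>f\<in>F. if f = f0 then \<Delta> else 0)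
      \<le> truck_length I vs (length vs - 1)"
      using plan f0 P2[of "length vs - 1"] rn by (simp add: is_plan_def ws_def)
  qed (use plan in \<open>simp add: is_plan_def\<close>)
  ultimately show ?thesis by (simp add: ws_def)
qed

section \<open>Sorties with one customer\<close>

lemma duration_3: "duration I [x, c, y] = drone_time I x c + drone_time I c y"
  by (simp add: duration_def flight_time_def)

lemma energy_3:
  "energy I [x, c, y] = drone_weight I * duration I [x, c, y] + payload I c * drone_time I x c"
  by (simp add: energy_def flight_time_def numeral_2_eq_2)

text \<open>Take for \<open>z\<close> the end closer to \<open>c\<close>. The round trip is at most
  the sum of both legs, and the payload is carried no farther than from \<open>x\<close>, so the
  energy does not grow either.\<close>

lemma loop_sortie:
  assumes I: "tspmd_instance I" and feas: "feasible_sortie I [x, c, y]"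
  shows "\<exists>z\<in>{x, y}. feasible_sortie I [z, c, z] \<and> duration I [z, c, z] \<le> duration I [x, c, y]"
proof -
  note comm = drone_time_commute[OF I]
  have w: "drone_weight I > 0" and pc: "payload I c \<ge> 0"
    using I feas by (auto simp: tspmd_instance_def feasible_sortie_def is_sortie_def)
  have "\<exists>z\<in>{x, y}. drone_time I z c \<le> drone_time I x c \<and> drone_time I z c \<le> drone_time I y c"
    by force
  then obtain z where z: "z \<in> {x, y}" "drone_time I z c \<le> drone_time I x c"
    "drone_time I z c \<le> drone_time I y c" by blast
  have dur: "duration I [z, c, z] \<le> duration I [x, c, y]"
    using z by (simp add: duration_3 comm[of c])
  have "energy I [z, c, z] \<le> energy I [x, c, y]"
    unfolding energy_3 using w pc z dur by (intro add_mono mult_left_mono) auto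
  then have "feasible_sortie I [z, c, z]"
    using feas z(1) by (auto simp: feasible_sortie_def is_sortie_def)
  then show ?thesis using z dur by blast
qed

lemma duration_rev_3:
  assumes "tspmd_instance I"
  shows "duration I (rev [x, c, y]) = duration I [x, c, y]"
  using drone_time_commute[OF assms] by (simp add: duration_3)

text \<open>Applied to the flights flown exactly along one traversal of the repeated arc, of which
  compatibility leaves at most one.\<close>

lemma sum_at_most_one_le:
  fixes l :: real
  assumes "finite F" "l \<ge> 0" "\<And>f g. f \<in> F \<Longrightarrow> g \<in> F \<Longrightarrow> Q f \<Longrightarrow> Q g \<Longrightarrow> f = g"
  shows "(\<Sum>f\<in>F. if Q f then l else 0) \<le> l"
proof -
  have "(\<Sum>f\<in>F. if Q f then l else 0) = real (card {f\<in>F. Q f}) * l"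
    using assms(1) by (simp add: sum.If_cases Int_def)
  moreover have "card {f\<in>F. Q f} \<le> Suc 0"
    using assms(1,3) by (subst card_le_Suc0_iff_eq) auto
  ultimately show ?thesis
    using assms(2) mult_right_mono[of "real (card {f\<in>F. Q f})" 1 l] by simp
qed

text \<open>
  Reversing the segment from visit \<open>a + 1\<close> to visit \<open>b\<close> turns both traversals of the repeated arc
  into waiting. This saves twice the length of the arc, which pays for the flights during these
  traversals: each of them is replaced by a loop flown while the truck waits at an end of the arc.
\<close>

lemma plan_reversal:
  assumes I: "tspmd_instance I" and plan: "is_plan I vs F"
    and inv: "\<And>\<pi>. feasible_sortie I \<pi> \<Longrightarrow> invertible_sortie I \<pi>"
    and one: "\<And>\<pi>. feasible_sortie I \<pi> \<Longrightarrow> card (served \<pi>) \<le> 1"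
    and ab: "Suc a < b" "Suc b < length vs" "vs ! a = vs ! b" "vs ! Suc a = vs ! Suc b"
    and clear: "\<And>f p. f \<in> F \<Longrightarrow> p \<in> {a, Suc a, b, Suc b} \<Longrightarrow>
      \<not> (launch_visit f < p \<and> p < land_visit f)"
  shows "\<exists>ws G. is_plan I ws G \<and> plan_cost I ws G \<le> plan_cost I vs F
    \<and> length ws = length vs \<and> ws ! a = ws ! Suc a"
proof -
  \<comment> \<open>An involution that reflects the positions \<open>Suc a\<close> to
    \<open>b\<close>. As the arc repeats, the new visits \<open>a\<close> and \<open>Suc a\<close>
    share a node, and so do \<open>b\<close> and \<open>Suc b\<close>.\<close>
  define r where "r t = (if Suc a \<le> t \<and> t \<le> b then Suc a + b - t else t)" for t
  define ws where "ws = map (\<lambda>t. vs ! r t) [0..<length vs]"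
  define l where "l = truck_time I (vs ! a) (vs ! Suc a)"
  let ?P = "truck_length I vs" and ?P' = "truck_length I ws"
  have r_less: "r t < length vs" if "t < length vs" for t
    using that ab by (auto simp: r_def)
  have rr: "r (r t) = t" for t by (auto simp: r_def)
  have nth_ws: "ws ! t = vs ! r t" if "t < length vs" for t
    using that by (simp add: ws_def)
  have nth_ws_r: "ws ! r t = vs ! t" if "t < length vs" for t
    using nth_ws[OF r_less[OF that]] rr by simp
  have len: "length ws = length vs" by (simp add: ws_def)
  have set_ws: "set ws = set vs"
  proof
    show "set ws \<subseteq> set vs" using r_less by (auto simp: ws_def)
    show "set vs \<subseteq> set ws" by (metis len nth_ws_r r_less in_set_conv_nth subsetI)
  qed
  have self: "truck_time I (vs ! t) (vs ! t) = 0" if "t < length vs" for t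
    using truck_time_facts(3)[OF I plan_nth_in_nodes[OF I plan that]] .
  have l0: "l \<ge> 0" using truck_time_facts(1)[OF I] by (simp add: l_def)
  have P1: "?P' t = ?P t" if "t \<le> a" for t
    using that ab by (induction t) (simp_all add: nth_ws r_def)
  \<comment> \<open>Inside the segment the truck drives the old one backwards from \<open>b\<close>,
    at equal cost by symmetry of the metric; the step from \<open>a\<close> to \<open>Suc a\<close>
    is free.\<close>
  have P2: "?P' t = ?P a + ?P b - ?P (Suc a + b - t)" if "Suc a \<le> t" "t \<le> b" for t
    using that
  proof (induction t rule: dec_induct)
    case base
    then show ?case using ab self[of b] by (simp add: P1 nth_ws r_def)
  next
    case (step t)
    define u where "u = a + b - t"
    have u: "r t = Suc u" "r (Suc t) = u" "Suc a + b - t = Suc u" "Suc a + b - Suc t = u"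
      using step by (auto simp: r_def u_def)
    show ?case
      using step ab u truck_time_facts(2)[OF I, of "vs ! u" "vs ! Suc u"] by (simp add: nth_ws)
  qed
  have P3: "?P' t = ?P t - 2 * l" if "Suc b \<le> t" "t < length vs" for t
    using that
  proof (induction t rule: dec_induct)
    case base
    then show ?case
      using ab self[of "Suc b"] P2[of b] by (simp add: nth_ws r_def l_def)
  next
    case (step t)
    then show ?case by (simp add: nth_ws r_def)
  qed
  have path3: "\<exists>x c y. path f = [x, c, y]" if "f \<in> F" for f
  proof -
    have f: "feasible_sortie I (path f)" using plan that by (simp add: is_plan_def is_flight_def)
    then have "length (path f) = 3"
      using one card_served_le_1_iff by (auto simp: feasible_sortie_def)
    then show ?thesis by (auto simp: numeral_3_eq_3 length_Suc_conv)
  qed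
  define arcf where "arcf f t \<longleftrightarrow> launch_visit f = t \<and> land_visit f = Suc t" for f :: "'a flight" and t
  \<comment> \<open>The admissible replacements \<open>g\<close> of \<open>f\<close>: unchanged
    outside the segment, reflected inside it, and a loop with allowance \<open>l\<close> along a
    traversal of the arc.\<close>
  define R where "R f g \<longleftrightarrow> is_flight I ws g \<and> served (path g) = served (path f) \<and>
    ((land_visit f \<le> a \<or> Suc b \<le> launch_visit f)
        \<and> launch_visit g = launch_visit f \<and> land_visit g = land_visit f
        \<and> excess I ws g \<le> excess I vs f
     \<or> Suc a \<le> launch_visit f \<and> land_visit f \<le> b
        \<and> launch_visit g = Suc a + b - land_visit f \<and> land_visit g = Suc a + b - launch_visit f
        \<and> excess I ws g \<le> excess I vs f
     \<or> (arcf f a \<or> arcf f b) \<and> land_visit g = launch_visit g \<and> launch_visit g \<in> {a, Suc b}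
        \<and> excess I ws g \<le> excess I vs f + l)" for f g
  have "\<exists>g. R f g" if f: "f \<in> F" for f
  proof -
    obtain x c y where xcy: "path f = [x, c, y]" using path3[OF f] by blast
    have ff: "feasible_sortie I (path f)" "launch_visit f \<le> land_visit f" "land_visit f < length vs"
      "x = vs ! launch_visit f" "y = vs ! land_visit f"
      using plan f xcy by (auto simp: is_plan_def is_flight_def)
    have "\<not> (launch_visit f < a \<and> a < land_visit f)"
      "\<not> (launch_visit f < Suc a \<and> Suc a < land_visit f)"
      "\<not> (launch_visit f < b \<and> b < land_visit f)"
      "\<not> (launch_visit f < Suc b \<and> Suc b < land_visit f)"
      using clear[OF f] by auto
    \<comment> \<open>By \<open>clear\<close>, no flight crosses one of the four visits, so each
      stays within one of the pieces into which they cut the route.\<close>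
    then have "\<not> land_visit f \<le> a \<Longrightarrow> \<not> Suc b \<le> launch_visit f \<Longrightarrow>
        (Suc a \<le> launch_visit f \<and> land_visit f \<le> b) \<or> arcf f a \<or> arcf f b"
      unfolding arcf_def using ff(2) ab(1) by linarith
    then consider "land_visit f \<le> a" | "Suc b \<le> launch_visit f"
      | "Suc a \<le> launch_visit f" "land_visit f \<le> b" | "arcf f a \<or> arcf f b"
      by blast
    then show ?thesis
    proof cases
      case 1
      have "is_flight I ws f"
        using ff xcy 1 ab by (simp add: is_flight_def len nth_ws r_def)
      moreover have "excess I ws f \<le> excess I vs f"
        using 1 ff(2) by (simp add: excess_def P1)
      ultimately show ?thesis using 1 unfolding R_def by blast
    next
      case 2
      have "is_flight I ws f"
        using ff xcy 2 ab by (simp add: is_flight_def len nth_ws r_def)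
      moreover have "excess I ws f \<le> excess I vs f"
        using 2 ff(2,3) by (simp add: excess_def P3)
      ultimately show ?thesis using 2 unfolding R_def by blast
    next
      case 3
      define g :: "'a flight" where "g = \<lparr>path = rev (path f), launch_visit = Suc a + b - land_visit f,
        land_visit = Suc a + b - launch_visit f\<rparr>"
      have r: "r (launch_visit f) = Suc a + b - launch_visit f" "r (land_visit f) = Suc a + b - land_visit f"
        using 3 ff(2) by (auto simp: r_def)
      have "Suc a + b - launch_visit f < length vs" using 3 ab by linarith
      then have "is_flight I ws g"
        using ff(2,3) 3 ab inv[OF ff(1)] ff(4,5) xcy r
          nth_ws_r[of "launch_visit f"] nth_ws_r[of "land_visit f"]
        by (simp add: is_flight_def g_def invertible_sortie_def len)
      moreover have "excess I ws g \<le> excess I vs f"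
        using 3 ff(2) ab xcy duration_rev_3[OF I, of x c y] by (simp add: excess_def g_def P2)
      moreover have "served (path g) = served (path f)"
        by (simp add: g_def xcy served_def)
      ultimately show ?thesis using 3 unfolding R_def by (intro exI[of _ g]) (simp add: g_def)
    next
      case 4
      have "feasible_sortie I [x, c, y]" using ff(1) xcy by simp
      from loop_sortie[OF I this] obtain z where z: "z \<in> {x, y}" "feasible_sortie I [z, c, z]"
        "duration I [z, c, z] \<le> duration I [x, c, y]" by blast
      have xy: "x = vs ! a" "y = vs ! Suc b" using 4 ff(4,5) ab by (auto simp: arcf_def)
      then obtain t where t: "t \<in> {a, Suc b}" "z = vs ! t" using z(1) by auto
      \<comment> \<open>The visits \<open>a\<close> and \<open>Suc b\<close> are fixed by
        \<open>r\<close>, and between them they offer both ends of the arc, whichever traversal the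
        flight accompanied.\<close>
      define g :: "'a flight" where "g = \<lparr>path = [z, c, z], launch_visit = t, land_visit = t\<rparr>"
      have "is_flight I ws g"
        using z t ab by (auto simp: is_flight_def g_def len nth_ws r_def)
      moreover have "excess I ws g \<le> excess I vs f + l"
      proof (rule excess_shift)
        show "?P (land_visit f) - ?P (launch_visit f) \<le> ?P' (land_visit g) - ?P' (launch_visit g) + l"
          using 4 ab by (auto simp: arcf_def g_def l_def)
      qed (use z xcy l0 in \<open>auto simp: g_def\<close>)
      moreover have "served (path g) = served (path f)"
        by (simp add: g_def xcy served_def)
      ultimately show ?thesis using 4 t unfolding R_def by (intro exI[of _ g]) (simp add: g_def)
    qed
  qed
  then obtain \<phi> where \<phi>: "\<And>f. f \<in> F \<Longrightarrow> R f (\<phi> f)" by metis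
  have le: "launch_visit f \<le> land_visit f" if "f \<in> F" for f
    using plan that by (auto simp: is_plan_def is_flight_def)
  have comp: "compatible f g" if "f \<in> F" "g \<in> F" "f \<noteq> g" for f g
    using plan that by (auto simp: is_plan_def pairwise_def)
  have "is_plan I ws (\<phi> ` F)"
  proof (rule is_planI)
    show "hd ws = depot I"
      using plan nth_ws[of 0] ab len by (auto simp: is_plan_def hd_conv_nth r_def simp flip: length_greater_0_conv)
    show "last ws = depot I"
      using plan nth_ws[of "length vs - 1"] ab len
      by (auto simp: is_plan_def last_conv_nth r_def simp flip: length_greater_0_conv)
    show "compatible f' g'" if fg': "f' \<in> \<phi> ` F" "g' \<in> \<phi> ` F" "f' \<noteq> g'" for f' g'
    proof -
      from fg' obtain f g where fg: "f \<in> F" "g \<in> F" "f' = \<phi> f" "g' = \<phi> g" "f \<noteq> g" by blast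
      \<comment> \<open>Reflected positions are described by sums, which avoids truncated
        subtraction in the arithmetic below.\<close>
      have cases: "(land_visit h \<le> a \<or> Suc b \<le> launch_visit h)
            \<and> launch_visit (\<phi> h) = launch_visit h \<and> land_visit (\<phi> h) = land_visit h
          \<or> Suc a \<le> launch_visit h \<and> land_visit h \<le> b
            \<and> launch_visit (\<phi> h) + land_visit h = Suc a + b
            \<and> land_visit (\<phi> h) + launch_visit h = Suc a + b
          \<or> land_visit (\<phi> h) = a \<and> launch_visit (\<phi> h) = a
          \<or> land_visit (\<phi> h) = Suc b \<and> launch_visit (\<phi> h) = Suc b"
        if "h \<in> F" for h
      proof -
        have "Suc a + b - land_visit h + land_visit h = Suc a + b" if "land_visit h \<le> b"
          using that by simp
        moreover have "Suc a + b - launch_visit h + launch_visit h = Suc a + b" if "land_visit h \<le> b"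
          using that le[OF \<open>h \<in> F\<close>] by simp
        ultimately show ?thesis
          using \<phi>[OF \<open>h \<in> F\<close>] unfolding R_def by (elim conjE disjE) simp_all
      qed
      show ?thesis
        using cases[OF fg(1)] cases[OF fg(2)] comp[OF fg(1,2,5)] le[OF fg(1)] le[OF fg(2)] ab(1)
        unfolding fg(3,4) compatible_def by (elim disjE conjE; simp)
    qed
    show "nodes I \<subseteq> set ws \<union> (\<Union>f\<in>\<phi> ` F. served (path f))"
      using plan \<phi> by (auto simp: is_plan_def set_ws R_def)
    show "is_flight I ws f" if "f \<in> \<phi> ` F" for f
      using that \<phi> by (auto simp: R_def)
  qed (use plan set_ws ab len in \<open>auto simp: is_plan_def\<close>)
  moreover have "plan_cost I ws (\<phi> ` F) \<le> plan_cost I vs F"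
  proof (rule plan_cost_image_le)
    show "finite F" using plan by (simp add: is_plan_def)
    show "excess I ws (\<phi> f) \<le> excess I vs f + ((if arcf f a then l else 0) + (if arcf f b then l else 0))"
      if "f \<in> F" for f
      using \<phi>[OF that] l0 unfolding R_def by auto
    \<comment> \<open>At most one flight per traversal is granted \<open>l\<close>; the total of
      \<open>2 * l\<close> is the saving in \<open>P3\<close>.\<close>
    have "(\<Sum>f\<in>F. if arcf f t then l else 0) \<le> l" for t
    proof (rule sum_at_most_one_le)
      show "f = g" if "f \<in> F" "g \<in> F" "arcf f t" "arcf g t" for f g
        using comp[of f g] that by (auto simp: compatible_def arcf_def)
    qed (use plan l0 in \<open>auto simp: is_plan_def\<close>)
    from this[of a] this[of b]
    show "truck_length I ws (length ws - 1)
        + (\<Sum>f\<in>F. (if arcf f a then l else 0) + (if arcf f b then l else 0))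
      \<le> truck_length I vs (length vs - 1)"
      using P3[of "length vs - 1"] ab by (simp add: len sum.distrib)
  qed
  moreover have "ws ! a = ws ! Suc a" using ab by (simp add: nth_ws r_def)
  ultimately show ?thesis using len by blast
qed

text \<open>Induction on the number of visits: each modification produces two equal consecutive
  nodes without raising the cost, and merging them shortens the route.\<close>

lemma plan_reduction:
  assumes I: "tspmd_instance I"
    and inv: "\<And>\<pi>. feasible_sortie I \<pi> \<Longrightarrow> invertible_sortie I \<pi>"
    and one: "\<And>\<pi>. feasible_sortie I \<pi> \<Longrightarrow> card (served \<pi>) \<le> 1"
    and plan: "is_plan I vs F"
  shows "\<exists>ws G. is_plan I ws G \<and> plan_cost I ws G \<le> plan_cost I vs F
    \<and> distinct_adj ws \<and> distinct (zip ws (tl ws))"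
  using plan
proof (induction "length vs" arbitrary: vs F rule: less_induct)
  case less
  have shrink: ?case if us: "is_plan I us H" "plan_cost I us H \<le> plan_cost I vs F"
    "length us = length vs" "Suc p < length us" "us ! p = us ! Suc p" for us H p
  proof -
    obtain ws G where G: "is_plan I ws G" "plan_cost I ws G \<le> plan_cost I us H" "length ws < length us"
      using plan_remove_repetition[OF I us(1,4,5)] by blast
    with less.hyps[of ws G] us show ?thesis by fastforce
  qed
  show ?case
  proof (cases "distinct_adj vs")
    case False
    then obtain p where "Suc p < length vs" "vs ! p = vs ! Suc p"
      by (auto simp: distinct_adj_conv_nth)
    with shrink[of vs F p] less.prems show ?thesis by simp
  next
    case da: True
    show ?thesis
    proof (cases "distinct (zip vs (tl vs))")
      case True
      with da less.prems show ?thesis by blast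
    next
      case False
      then obtain a b where "a < b" "b < length (zip vs (tl vs))" "zip vs (tl vs) ! a = zip vs (tl vs) ! b"
        unfolding distinct_conv_nth by (metis linorder_neqE_nat)
      then have ab: "a < b" "Suc b < length vs" "vs ! a = vs ! b" "vs ! Suc a = vs ! Suc b"
        by (auto simp: nth_tl)
      have ne: "vs ! t \<noteq> vs ! Suc t" if "Suc t < length vs" for t
        using da that by (auto simp: distinct_adj_conv_nth)
      \<comment> \<open>If \<open>Suc a = b\<close>, the repeated arc would give
        \<open>vs ! b = vs ! Suc b\<close>.\<close>
      have ab': "Suc a < b" using ab ne[of b] by (metis Suc_lessI)
      show ?thesis
      proof (cases "\<exists>f\<in>F. \<exists>p\<in>{a, Suc a, b, Suc b}. launch_visit f < p \<and> p < land_visit f")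
        case True
        then obtain f p where fp: "f \<in> F" "p \<in> {a, Suc a, b, Suc b}" "launch_visit f < p" "p < land_visit f"
          by blast
        then obtain u where u: "p = Suc u" by (cases p) auto
        \<comment> \<open>The corresponding end of the other traversal.\<close>
        obtain q where q: "q < length vs" "q \<noteq> p" "vs ! q = vs ! p"
        proof -
          from fp(2) consider "p = a" | "p = Suc a" | "p = b" | "p = Suc b" by blast
          then show thesis
            using that[of a] that[of b] that[of "Suc a"] that[of "Suc b"] ab ab' by cases auto
        qed
        have "p < length vs" using fp(2) ab by auto
        with shrink[of "vs[Suc u := vs ! u]" F u] plan_shortcut[OF I less.prems fp(1), of u q] fp q u
        show ?thesis by simp
      next
        case False
        then obtain us H where "is_plan I us H" "plan_cost I us H \<le> plan_cost I vs F"
          "length us = length vs" "us ! a = us ! Suc a"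
          using plan_reversal[OF I less.prems inv one ab' ab(2-4)] by blast
        with shrink[of us H a] ab show ?thesis by simp
      qed
    qed
  qed
qed

subsection \<open>Existence of an optimal solution\<close>

text \<open>Distinct arcs bound the length of the route, hence also the visit indices of the
  flights, and every sortie has three nodes.\<close>

lemma finite_reduced_plans:
  assumes I: "tspmd_instance I"
    and one: "\<And>\<pi>. feasible_sortie I \<pi> \<Longrightarrow> card (served \<pi>) \<le> 1"
  shows "finite {(vs, F). is_plan I vs F \<and> distinct_adj vs \<and> distinct (zip vs (tl vs))}"
proof -
  \<comment> \<open>A route with \<open>k\<close> arcs has \<open>k + 1\<close> visits.\<close>
  define n where "n = card (nodes I \<times> nodes I) + 1"
  define V where "V = {vs. set vs \<subseteq> nodes I \<and> length vs \<le> n}"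
  define W where "W = (\<lambda>(p, s, e). \<lparr>path = p, launch_visit = s, land_visit = e\<rparr>) `
    ({p. set p \<subseteq> nodes I \<and> length p = 3} \<times> {..n} \<times> {..n})"
  have fin: "finite (nodes I)" and sub: "truck_nodes I \<subseteq> nodes I" "drone_nodes I \<subseteq> nodes I"
    using I by (auto simp: tspmd_instance_def)
  have "finite V" "finite W"
    using finite_lists_length_le[OF fin] finite_lists_length_eq[OF fin] by (auto simp: V_def W_def)
  then have "finite (V \<times> Pow W)" by simp
  moreover have "vs \<in> V \<and> F \<subseteq> W" if plan: "is_plan I vs F" and d: "distinct (zip vs (tl vs))" for vs F
  proof -
    have vs: "set vs \<subseteq> nodes I" using plan sub by (auto simp: is_plan_def)
    have "set (zip vs (tl vs)) \<subseteq> nodes I \<times> nodes I"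
      using vs list.set_sel(2)[of vs] plan unfolding is_plan_def
      by (auto dest: set_zip_leftD set_zip_rightD)
    then have "card (set (zip vs (tl vs))) \<le> card (nodes I \<times> nodes I)"
      using fin by (intro card_mono) auto
    then have len: "length vs \<le> n"
      using distinct_card[OF d] by (simp add: n_def)
    have "f \<in> W" if "f \<in> F" for f
    proof -
      have f: "is_flight I vs f" using plan that by (simp add: is_plan_def)
      then have s: "is_sortie I (path f)" "length (path f) = 3"
        using one[of "path f"] card_served_le_1_iff[of I "path f"]
        by (auto simp: is_flight_def feasible_sortie_def)
      then obtain x c y where "path f = [x, c, y]" by (auto simp: numeral_3_eq_3 length_Suc_conv)
      with s sub have "set (path f) \<subseteq> nodes I" by (auto simp: is_sortie_def)
      with s f len show ?thesis
        unfolding W_def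
        by (intro image_eqI[of _ _ "(path f, launch_visit f, land_visit f)"]) (auto simp: is_flight_def)
    qed
    with vs len show ?thesis by (auto simp: V_def)
  qed
  then have "{(vs, F). is_plan I vs F \<and> distinct_adj vs \<and> distinct (zip vs (tl vs))} \<subseteq> V \<times> Pow W"
    by blast
  ultimately show ?thesis by (rule rev_finite_subset)
qed

lemma distinct_count_list_le: "distinct xs \<Longrightarrow> count_list xs x \<le> 1"
  by (induction xs) auto

theorem proposition4p3:
  fixes I :: "'a tspmd"
  assumes "tspmd_instance I"
    and "\<exists>S. feasible_solution I S"
    and "num_drones I = 1"
    and "\<And>\<pi>. feasible_sortie I \<pi> \<Longrightarrow> invertible_sortie I \<pi>"
    and "\<And>\<pi>. feasible_sortie I \<pi> \<Longrightarrow> card (served \<pi>) \<le> 1"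
  shows "\<exists>S. optimal_solution I S \<and> \<not> arc_retraversing I S"
proof -
  define X where "X = {(vs, F). is_plan I vs F \<and> distinct_adj vs \<and> distinct (zip vs (tl vs))}"
  have better: "\<exists>x\<in>X. case_prod (plan_cost I) x \<le> completion_time I S" if S: "feasible_solution I S" for S
  proof -
    obtain fs where fs: "flights S = [fs]"
      using S assms(3) by (auto simp: feasible_solution_def length_Suc_conv)
    obtain ws G where G: "is_plan I ws G" "plan_cost I ws G \<le> plan_cost I (route S) (set fs)"
      "distinct_adj ws" "distinct (zip ws (tl ws))"
      using plan_reduction[OF assms(1,4,5) solution_plan[OF S fs]] by blast
    with plan_cost_le_completion_time[OF assms(1) S fs] show ?thesis
      by (intro bexI[of _ "(ws, G)"]) (auto simp: X_def)
  qed
  have "finite X" using finite_reduced_plans[OF assms(1,5)] by (simp add: X_def)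
  moreover have "X \<noteq> {}" using better assms(2) by blast
  \<comment> \<open>Minimizing over the finite set of reduced plans suffices, since by
    \<open>better\<close> every completion time is bounded below by the cost of one of them.\<close>
  ultimately obtain x where "is_arg_min (case_prod (plan_cost I)) (\<lambda>x. x \<in> X) x"
    using ex_is_arg_min_if_finite by blast
  then have x: "x \<in> X" "\<And>y. y \<in> X \<Longrightarrow> case_prod (plan_cost I) x \<le> case_prod (plan_cost I) y"
    by (simp_all only: is_arg_min_linorder)
  obtain vs F where vF: "x = (vs, F)" by (cases x)
  with x have plan: "is_plan I vs F" "distinct_adj vs" "distinct (zip vs (tl vs))"
    by (auto simp: X_def)
  obtain S where S: "feasible_solution I S" "route S = vs" "completion_time I S \<le> plan_cost I vs F"
    using plan_solution[OF assms(1,3) plan(1,2)] by blast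
  have "optimal_solution I S"
    unfolding optimal_solution_def
  proof (intro conjI allI impI S(1))
    fix S' assume "feasible_solution I S'"
    from better[OF this] obtain y where "y \<in> X" "case_prod (plan_cost I) y \<le> completion_time I S'"
      by blast
    \<comment> \<open>The solution built from the cheapest plan costs at most \<open>x\<close>,
      hence at most \<open>y\<close>, hence at most \<open>S'\<close>.\<close>
    with x(2)[of y] S(3) vF show "completion_time I S \<le> completion_time I S'" by simp
  qed
  moreover have "\<not> arc_retraversing I S"
    using distinct_count_list_le[OF plan(3)] by (simp add: arc_retraversing_def S(2) not_less)
  ultimately show ?thesis by blast
qed

end
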